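(* Let $G$ be a finitely generated group in the variety $\mathcal U\mathcal N\mathcal N$, i.e. $G$ has a normal abelian subgroup $A$ such that $G/A$ has a normal nilpotent subgroup with nilpotent quotient. Then for every finite generating set $X$ of $G$, $\mathrm{pw}(G,X)<\infty$.
   Context: $\mathcal U$ denotes the variety of abelian groups and $\mathcal N$ the class of nilpotent groups; $\mathcal U\mathcal N\mathcal N$ is the class of abelian-by-nilpotent-by-nilpotent groups as described. For a group $G$ generated by a set $X$, a palindrome is an element of $G$ represented by a reduced word in $X^{\pm1}$ that reads the same forwards and backwards; $l_{\mathcal P}(g)$ is the minimal number of palindromes whose product is $g$, and $\mathrm{pw}(G,X)=\sup_{g\in G} l_{\mathcal P}(g)$. *)

theory Defs
  imports "HOL-Algebra.Algebra"
begin

fun lower_central :: "('a, 'b) monoid_scheme \<Rightarrow> nat \<Rightarrow> 'a set" where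
  "lower_central H 0 = carrier H"
| "lower_central H (Suc n) =
     generate H {x \<otimes>\<^bsub>H\<^esub> y \<otimes>\<^bsub>H\<^esub> inv\<^bsub>H\<^esub> x \<otimes>\<^bsub>H\<^esub> inv\<^bsub>H\<^esub> y | x y.
                  x \<in> carrier H \<and> y \<in> lower_central H n}"

definition nilpotent_group :: "('a, 'b) monoid_scheme \<Rightarrow> bool" where
  "nilpotent_group H \<longleftrightarrow> group H \<and> (\<exists>n. lower_central H n = {\<one>\<^bsub>H\<^esub>})"

definition UNN_group :: "('a, 'b) monoid_scheme \<Rightarrow> bool" where
  "UNN_group G \<longleftrightarrow> group G \<and>
     (\<exists>A. A \<lhd> G \<and> comm_group (G\<lparr>carrier := A\<rparr>) \<and>
        (\<exists>N. N \<lhd> (G Mod A) \<and> nilpotent_group ((G Mod A)\<lparr>carrier := N\<rparr>) \<and>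
             nilpotent_group ((G Mod A) Mod N)))"

definition word_eval :: "('a, 'b) monoid_scheme \<Rightarrow> ('a \<times> bool) list \<Rightarrow> 'a" where
  "word_eval G w = foldr (\<lambda>(x, b) acc. (if b then x else inv\<^bsub>G\<^esub> x) \<otimes>\<^bsub>G\<^esub> acc) w \<one>\<^bsub>G\<^esub>"

definition reduced_word :: "('a \<times> bool) list \<Rightarrow> bool" where
  "reduced_word w \<longleftrightarrow>
     (\<forall>i. Suc i < length w \<longrightarrow> \<not> (fst (w ! i) = fst (w ! Suc i) \<and> snd (w ! i) \<noteq> snd (w ! Suc i)))"

definition palindromes :: "('a, 'b) monoid_scheme \<Rightarrow> 'a set \<Rightarrow> 'a set" where
  "palindromes G S = {word_eval G w | w. set (map fst w) \<subseteq> S \<and> reduced_word w \<and> rev w = w}"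

definition finite_palindromic_width :: "('a, 'b) monoid_scheme \<Rightarrow> 'a set \<Rightarrow> bool" where
  "finite_palindromic_width G S \<longleftrightarrow>
     (\<exists>N::nat. \<forall>g \<in> carrier G. \<exists>ps. length ps \<le> N \<and> set ps \<subseteq> palindromes G S \<and>
                                   foldr (\<lambda>p acc. p \<otimes>\<^bsub>G\<^esub> acc) ps \<one>\<^bsub>G\<^esub> = g)"

end

theory Submission
  imports Defs
begin

text \<open>For a generator \<open>x\<close> every commutator \<open>[x, g]\<close> is a product of three palindromes, so for each fixed
  \<open>t\<close> the set of all \<open>[t, g]\<close> has bounded palindromic length. Choose \<open>H\<close>, a term of the lower central
  series of \<open>G\<close>, such that some term of the lower central series \<open>H\<^sub>0 = H, H\<^sub>1, \<dots>\<close> of \<open>H\<close> is abelian;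
  \<open>H\<close> is the normal closure of finitely many elements \<open>t\<^sub>j\<close>. Two observations climb up both series.
  If \<open>B\<close> is normal and abelian modulo \<open>K\<close>, then \<open>[G, B]\<close> is, modulo \<open>K\<close>, the product of the sets
  \<open>[x, B]\<close> over the generators \<open>x\<close>. And modulo \<open>[G, [H, B]]\<close> the commutator is a bimultiplicative
  \<open>G\<close>-invariant pairing of \<open>H\<close> and \<open>B\<close>, so that conjugating the first argument can be undone on the
  second and \<open>[H, B]\<close> is the product of the sets \<open>[t\<^sub>j, B]\<close>. Hence boundedness passes from \<open>[G, H\<^sub>i\<^sub>+\<^sub>1]\<close>
  to \<open>H\<^sub>i\<^sub>+\<^sub>1\<close> and then to \<open>[G, H\<^sub>i]\<close>, and finally from \<open>[G, H]\<close> up to \<open>G\<close> itself.\<close>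

section \<open>Commutator subgroups and lower series inside an ambient group\<close>

definition comm_subgroup :: "('a, 'b) monoid_scheme \<Rightarrow> 'a set \<Rightarrow> 'a set \<Rightarrow> 'a set" where
  "comm_subgroup G H B =
     generate G {x \<otimes>\<^bsub>G\<^esub> y \<otimes>\<^bsub>G\<^esub> inv\<^bsub>G\<^esub> x \<otimes>\<^bsub>G\<^esub> inv\<^bsub>G\<^esub> y | x y. x \<in> H \<and> y \<in> B}"

text \<open>All terms are formed in the ambient \<open>G\<close> rather than in \<open>H\<close> as
  a group of its own, so that normality in \<open>G\<close> passes from each term to the
  next.\<close>

fun lower_series :: "('a, 'b) monoid_scheme \<Rightarrow> 'a set \<Rightarrow> nat \<Rightarrow> 'a set" where
  "lower_series G H 0 = H"
| "lower_series G H (Suc n) = comm_subgroup G H (lower_series G H n)"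

context group
begin

definition commutator :: "'a \<Rightarrow> 'a \<Rightarrow> 'a" where
  "commutator x y = x \<otimes> y \<otimes> inv x \<otimes> inv y"

lemma inv_mult_cancel_left:
  assumes "x \<in> carrier G" "y \<in> carrier G"
  shows "inv x \<otimes> (x \<otimes> y) = y" and "x \<otimes> (inv x \<otimes> y) = y"
  using assms by (simp_all add: m_assoc [symmetric])

lemmas word_simps = commutator_def m_assoc inv_mult_group inv_mult_cancel_left

lemma commutator_closed [simp, intro]:
  "x \<in> carrier G \<Longrightarrow> y \<in> carrier G \<Longrightarrow> commutator x y \<in> carrier G"
  by (simp add: commutator_def)

lemma normal_in_carrier: "B \<lhd> G \<Longrightarrow> b \<in> B \<Longrightarrow> b \<in> carrier G"
  by (meson normal_imp_subgroup subgroup.mem_carrier)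

lemma normal_mult: "B \<lhd> G \<Longrightarrow> a \<in> B \<Longrightarrow> b \<in> B \<Longrightarrow> a \<otimes> b \<in> B"
  by (meson normal_imp_subgroup subgroup.m_closed)

lemma normal_inv: "B \<lhd> G \<Longrightarrow> a \<in> B \<Longrightarrow> inv a \<in> B"
  by (meson normal_imp_subgroup subgroup.m_inv_closed)

lemma normal_conj:
  assumes "B \<lhd> G" "x \<in> carrier G" "b \<in> B"
  shows "x \<otimes> b \<otimes> inv x \<in> B" and "inv x \<otimes> b \<otimes> x \<in> B"
  using assms by (auto intro: normal.inv_op_closed1 normal.inv_op_closed2)

lemma normal_commutator:
  assumes "B \<lhd> G" "x \<in> carrier G" "b \<in> B"
  shows "commutator x b \<in> B"
  unfolding commutator_def using assms by (intro normal_mult normal_inv normal_conj)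

lemma comm_subgroup_eq:
  "comm_subgroup G H B = generate G {commutator x y | x y. x \<in> H \<and> y \<in> B}"
  by (simp add: comm_subgroup_def commutator_def)

lemma commutator_in_comm_subgroup:
  "x \<in> H \<Longrightarrow> y \<in> B \<Longrightarrow> commutator x y \<in> comm_subgroup G H B"
  unfolding comm_subgroup_eq by (auto intro!: generate.incl)

lemma comm_subgroup_least:
  assumes "subgroup L G" "\<And>x y. x \<in> H \<Longrightarrow> y \<in> B \<Longrightarrow> commutator x y \<in> L"
  shows "comm_subgroup G H B \<subseteq> L"
  unfolding comm_subgroup_eq using assms by (intro generate_subgroup_incl) auto

lemma normal_comm_subgroup:
  assumes "H \<lhd> G" "B \<lhd> G"
  shows "comm_subgroup G H B \<lhd> G"
  unfolding comm_subgroup_eq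
proof (rule normal_generateI)
  note c = normal_in_carrier [OF assms(1)] normal_in_carrier [OF assms(2)]
  show "{commutator x y |x y. x \<in> H \<and> y \<in> B} \<subseteq> carrier G"
    using c by auto
  fix z g
  assume "z \<in> {commutator x y |x y. x \<in> H \<and> y \<in> B}" and g: "g \<in> carrier G"
  then obtain x y where xy: "x \<in> H" "y \<in> B" and z: "z = commutator x y"
    by blast
  have "g \<otimes> z \<otimes> inv g = commutator (g \<otimes> x \<otimes> inv g) (g \<otimes> y \<otimes> inv g)"
    using xy g c by (simp add: z word_simps)
  moreover have "g \<otimes> x \<otimes> inv g \<in> H" "g \<otimes> y \<otimes> inv g \<in> B"
    using xy g assms normal_conj by blast+
  ultimately show "g \<otimes> z \<otimes> inv g \<in> {commutator x y |x y. x \<in> H \<and> y \<in> B}"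
    by blast
qed

lemma comm_subgroup_subset:
  assumes "H \<subseteq> carrier G" "B \<lhd> G"
  shows "comm_subgroup G H B \<subseteq> B"
  using assms by (intro comm_subgroup_least normal_imp_subgroup normal_commutator) auto

lemma normal_lower_series: "H \<lhd> G \<Longrightarrow> lower_series G H n \<lhd> G"
  by (induction n) (auto intro: normal_comm_subgroup)

text \<open>Links nilpotency, which concerns \<open>H\<close> as a group in its own right, with
  terms computed in \<open>G\<close>: products and inverses are inherited. The inclusion in
  \<open>H\<close> is proved along with the equality because \<open>generate_consistent\<close>
  needs the commutators to lie in \<open>H\<close>.\<close>

lemma lower_central_subgroup:
  assumes "subgroup H G"
  shows "lower_central (G\<lparr>carrier := H\<rparr>) n = lower_series G H n \<and> lower_series G H n \<subseteq> H"
proof (induction n)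
  case (Suc n)
  interpret H: group "G\<lparr>carrier := H\<rparr>"
    by (rule subgroup_imp_group [OF assms])
  let ?C = "{x \<otimes> y \<otimes> inv x \<otimes> inv y | x y. x \<in> H \<and> y \<in> lower_series G H n}"
  have inv_eq: "inv\<^bsub>G\<lparr>carrier := H\<rparr>\<^esub> x = inv x" if "x \<in> H" for x
    using that assms by simp
  have sub: "?C \<subseteq> H"
    using Suc assms by (auto intro!: subgroup.m_closed [OF assms] subgroup.m_inv_closed [OF assms])
  have "lower_central (G\<lparr>carrier := H\<rparr>) (Suc n) = generate (G\<lparr>carrier := H\<rparr>) ?C"
    using Suc inv_eq by (auto intro!: arg_cong [where f = "generate (G\<lparr>carrier := H\<rparr>)"]) (metis subset_iff)+
  also have "\<dots> = generate G ?C"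
    using generate_consistent [OF sub assms] by simp
  finally show ?case
    using generate_subgroup_incl [OF sub assms] by (simp add: comm_subgroup_def)
qed auto

lemma lower_central_eq: "lower_central G n = lower_series G (carrier G) n"
  using lower_central_subgroup [OF subgroup_self, of n] by simp

end

text \<open>Homomorphisms send commutators to commutators. Applied to quotient maps, this turns
  triviality of a lower series in the quotient into a statement about \<open>G\<close>.\<close>

lemma (in group_hom) image_lower_series:
  assumes "A \<subseteq> carrier G" "B \<subseteq> carrier H" "h ` A \<subseteq> B"
  shows "lower_series G A n \<subseteq> carrier G \<and> h ` lower_series G A n \<subseteq> lower_series H B n"
proof (induction n)
  case (Suc n)
  let ?C = "{G.commutator x y |x y. x \<in> A \<and> y \<in> lower_series G A n}"
  let ?D = "{H.commutator x y |x y. x \<in> B \<and> y \<in> lower_series H B n}"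
  have C: "?C \<subseteq> carrier G"
    using Suc assms by auto
  have "h ` ?C \<subseteq> ?D"
  proof clarify
    fix x y assume xy: "x \<in> A" "y \<in> lower_series G A n"
    then have "h (G.commutator x y) = H.commutator (h x) (h y)"
      using Suc assms by (auto simp: G.commutator_def H.commutator_def subset_iff)
    then show "\<exists>u v. h (G.commutator x y) = H.commutator u v \<and> u \<in> B \<and> v \<in> lower_series H B n"
      using xy Suc assms by blast
  qed
  then have "generate H (h ` ?C) \<subseteq> generate H ?D"
    by (rule H.mono_generate)
  then show ?case
    using generate_img [OF C] G.generate_incl [OF C]
    by (simp add: G.comm_subgroup_eq H.comm_subgroup_eq)
qed (use assms in auto)

section \<open>Elements commuting with \<open>B\<close> modulo \<open>L\<close>, and normal
  generation\<close>

text \<open>The usual expansion of \<open>[g h, b]\<close> contains a conjugate of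
  \<open>[h, b]\<close>, which could leave a subgroup \<open>L\<close> that is not normal. Writing
  it as \<open>[g, [h, b]] [h, b] [g, b]\<close> avoids conjugation, because \<open>[h, b]\<close>
  lies in \<open>B\<close> again.\<close>

lemma (in group) subgroup_commutator_left:
  assumes B: "B \<lhd> G" and L: "subgroup L G"
  shows "subgroup {g \<in> carrier G. \<forall>b\<in>B. commutator g b \<in> L} G"
proof (rule subgroupI)
  note c = normal_in_carrier [OF B]
  show "{g \<in> carrier G. \<forall>b\<in>B. commutator g b \<in> L} \<noteq> {}"
    using L c by (auto intro!: exI [of _ \<one>] simp: commutator_def subgroup.one_closed)
  fix g assume g: "g \<in> {g \<in> carrier G. \<forall>b\<in>B. commutator g b \<in> L}"
  have "commutator (inv g) b \<in> L" if b: "b \<in> B" for b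
  proof -
    have "commutator (inv g) b = inv (commutator g (inv g \<otimes> b \<otimes> g))"
      using g b c by (simp add: word_simps)
    moreover have "inv g \<otimes> b \<otimes> g \<in> B"
      using g b B normal_conj by blast
    ultimately show ?thesis
      using g L subgroup.m_inv_closed by fastforce
  qed
  then show "inv g \<in> {g \<in> carrier G. \<forall>b\<in>B. commutator g b \<in> L}"
    using g by simp
  fix h assume h: "h \<in> {g \<in> carrier G. \<forall>b\<in>B. commutator g b \<in> L}"
  have "commutator (g \<otimes> h) b \<in> L" if b: "b \<in> B" for b
  proof -
    have "commutator (g \<otimes> h) b = commutator g (commutator h b) \<otimes> commutator h b \<otimes> commutator g b"
      using g h b c by (simp add: word_simps)
    moreover have "commutator h b \<in> B"
      using h b B normal_commutator by blast
    ultimately show ?thesis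
      using g h b L by (simp add: subgroup.m_closed)
  qed
  then show "g \<otimes> h \<in> {g \<in> carrier G. \<forall>b\<in>B. commutator g b \<in> L}"
    using g h by simp
qed auto

text \<open>Conjugating the first argument is undone on the second:
  \<open>[x g x^-1, b] = x [g, x^-1 b x] x^-1\<close>, and \<open>B\<close> absorbs the inner
  conjugate.\<close>

lemma (in group) normal_commutator_left:
  assumes B: "B \<lhd> G" and L: "L \<lhd> G"
  shows "{g \<in> carrier G. \<forall>b\<in>B. commutator g b \<in> L} \<lhd> G"
proof (rule normal_invI)
  note c = normal_in_carrier [OF B]
  show "subgroup {g \<in> carrier G. \<forall>b\<in>B. commutator g b \<in> L} G"
    by (intro subgroup_commutator_left B normal_imp_subgroup L)
  fix x g assume x: "x \<in> carrier G" and g: "g \<in> {g \<in> carrier G. \<forall>b\<in>B. commutator g b \<in> L}"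
  have "commutator (x \<otimes> g \<otimes> inv x) b \<in> L" if b: "b \<in> B" for b
  proof -
    have "commutator (x \<otimes> g \<otimes> inv x) b = x \<otimes> commutator g (inv x \<otimes> b \<otimes> x) \<otimes> inv x"
      using x g b c by (simp add: word_simps)
    moreover have "inv x \<otimes> b \<otimes> x \<in> B"
      using x b B normal_conj by blast
    ultimately show ?thesis
      using x g L normal_conj by simp
  qed
  then show "x \<otimes> g \<otimes> inv x \<in> {g \<in> carrier G. \<forall>b\<in>B. commutator g b \<in> L}"
    using x g by simp
qed

text \<open>For normal \<open>H\<close> this says that \<open>H\<close> is the normal closure of
  \<open>T\<close>. In this form, \<open>H \<subseteq> K\<close> follows for a normal
  \<open>K\<close> as soon as \<open>T \<subseteq> K\<close>.\<close>

definition normally_generates :: "('a, 'b) monoid_scheme \<Rightarrow> 'a set \<Rightarrow> 'a set \<Rightarrow> bool" where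
  "normally_generates G T H \<longleftrightarrow> T \<subseteq> H \<and> (\<forall>K. K \<lhd> G \<and> T \<subseteq> K \<longrightarrow> H \<subseteq> K)"

text \<open>Modulo the normal closure of the commutators \<open>[x, t]\<close>, every \<open>t\<close> commutes with the
  generators \<open>x\<close> and is therefore central; the centre being normal, all of \<open>H\<close> is central.\<close>

lemma (in group) normally_generates_comm_subgroup:
  assumes S: "S \<subseteq> carrier G" "generate G S = carrier G"
    and H: "H \<subseteq> carrier G" and T: "normally_generates G T H"
  shows "normally_generates G {commutator x t | x t. x \<in> S \<and> t \<in> T} (comm_subgroup G (carrier G) H)"
proof -
  have TH: "T \<subseteq> H" using T by (simp add: normally_generates_def)
  have "comm_subgroup G (carrier G) H \<subseteq> K"
    if K: "K \<lhd> G" and sub: "{commutator x t | x t. x \<in> S \<and> t \<in> T} \<subseteq> K" for K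
  proof -
    have Ks: "subgroup K G" using K by (rule normal_imp_subgroup)
    let ?Z = "{z \<in> carrier G. \<forall>g\<in>carrier G. commutator z g \<in> K}"
    have Z: "?Z \<lhd> G" by (rule normal_commutator_left [OF normal_self K])
    have flip: "commutator y x = inv (commutator x y)" if "x \<in> carrier G" "y \<in> carrier G" for x y
      using that by (simp add: word_simps)
    have "T \<subseteq> ?Z"
    proof
      fix t assume t: "t \<in> T"
      then have tc: "t \<in> carrier G" using TH H by auto
      \<comment> \<open>This is the centraliser of the single element \<open>t\<close> modulo
        \<open>K\<close>. Since \<open>{t}\<close> is not a normal subgroup,
        \<open>subgroup_commutator_left\<close> does not apply; normality of \<open>K\<close> takes
        its place.\<close>
      have "generate G S \<subseteq> {g \<in> carrier G. commutator g t \<in> K}"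
      proof (rule generate_subgroup_incl)
        show "S \<subseteq> {g \<in> carrier G. commutator g t \<in> K}"
          using S(1) sub t by blast
        have inv_eq: "commutator (inv g) t = inv (inv g \<otimes> commutator g t \<otimes> g)"
          if "g \<in> carrier G" for g
          using that tc by (simp add: word_simps)
        have mult_eq: "commutator (g \<otimes> h) t = (g \<otimes> commutator h t \<otimes> inv g) \<otimes> commutator g t"
          if "g \<in> carrier G" "h \<in> carrier G" for g h
          using that tc by (simp add: word_simps)
        show "subgroup {g \<in> carrier G. commutator g t \<in> K} G"
        proof (rule subgroupI)
          show "{g \<in> carrier G. commutator g t \<in> K} \<noteq> {}"
            using Ks tc by (auto intro!: exI [of _ \<one>] simp: commutator_def subgroup.one_closed)
        next
          fix g assume "g \<in> {g \<in> carrier G. commutator g t \<in> K}"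
          then show "inv g \<in> {g \<in> carrier G. commutator g t \<in> K}"
            using inv_eq [of g] K normal_conj(2) normal_inv by simp
        next
          fix g h assume "g \<in> {g \<in> carrier G. commutator g t \<in> K}" "h \<in> {g \<in> carrier G. commutator g t \<in> K}"
          then show "g \<otimes> h \<in> {g \<in> carrier G. commutator g t \<in> K}"
            using mult_eq [of g h] K normal_conj(1) normal_mult by simp
        qed auto
      qed
      then have "commutator g t \<in> K" if "g \<in> carrier G" for g
        using that S(2) by blast
      then show "t \<in> ?Z"
        using tc K normal_inv flip [of _ t] by auto
    qed
    then have "H \<subseteq> ?Z"
      using T Z unfolding normally_generates_def by blast
    show ?thesis
    proof (rule comm_subgroup_least [OF Ks])
      fix x y assume xy: "x \<in> carrier G" "y \<in> H"
      then have "inv (commutator y x) \<in> K"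
        using \<open>H \<subseteq> ?Z\<close> K normal_inv by blast
      then show "commutator x y \<in> K"
        using xy H flip [of y x] by auto
    qed
  qed
  then show ?thesis
    using S(1) TH unfolding normally_generates_def
    by (auto intro!: commutator_in_comm_subgroup)
qed

section \<open>Reduced words and palindromic words\<close>

lemma reduced_word_iff_successively:
  "reduced_word w \<longleftrightarrow> successively (\<lambda>a b. \<not> (fst a = fst b \<and> snd a \<noteq> snd b)) w"
  by (auto simp: reduced_word_def successively_conv_nth)

lemma palindrome_cases:
  assumes "rev w = w"
  obtains "w = []" | a where "w = [a]" | a v where "w = a # v @ [a]" "rev v = v"
proof (cases w)
  case (Cons a w')
  then show ?thesis
  proof (cases w' rule: rev_cases)
    case Nil
    then show ?thesis using that(2) Cons by simp
  next
    case (snoc v b)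
    have "b # (rev v @ [a]) = a # (v @ [b])"
      using assms unfolding Cons snoc by (simp only: rev.simps rev_append append.simps)
    then have "b = a" and *: "rev v @ [a] = v @ [b]" by (simp_all only: list.inject)
    from * have "rev v = v" by (simp only: append1_eq_conv)
    then show ?thesis using that(3) [of a v] \<open>b = a\<close> unfolding Cons snoc by blast
  qed
qed (use that(1) in simp)

lemma successively_snoc2:
  "successively P (w @ [a, b]) \<longleftrightarrow> successively P (w @ [a]) \<and> P a b"
  by (cases w rule: rev_cases) (auto simp: successively_append_iff)

text \<open>The new junctions are \<open>a b\<close> on the left and \<open>b a\<close> on the
  right, and cancellation is symmetric, so one condition covers both.\<close>

lemma reduced_word_enclose:
  "reduced_word (a # (b # v @ [b]) @ [a]) \<longleftrightarrow>
     reduced_word (b # v @ [b]) \<and> \<not> (fst b = fst a \<and> snd b \<noteq> snd a)"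
  unfolding reduced_word_iff_successively
  using successively_snoc2 [of "\<lambda>a b. \<not> (fst a = fst b \<and> snd a \<noteq> snd b)" "a # b # v" b a]
  by auto

lemma reduced_word_inner: "reduced_word (b # v @ [b]) \<Longrightarrow> reduced_word v"
  by (auto simp: reduced_word_iff_successively successively_append_iff successively_Cons)

section \<open>Bounded palindromic length, and words in finitely many generators\<close>

lemma set_multI: "a \<in> A \<Longrightarrow> b \<in> B \<Longrightarrow> a \<otimes>\<^bsub>G\<^esub> b \<in> A <#>\<^bsub>G\<^esub> B"
  by (auto simp: set_mult_def)

text \<open>Finite palindromic width relativised to a subset \<open>T\<close>;
  \<open>T = carrier G\<close> gives back the width of the group.\<close>

definition palindromically_bounded :: "('a, 'b) monoid_scheme \<Rightarrow> 'a set \<Rightarrow> 'a set \<Rightarrow> bool" where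
  "palindromically_bounded G S T \<longleftrightarrow>
     (\<exists>N::nat. \<forall>g\<in>T. \<exists>ps. length ps \<le> N \<and> set ps \<subseteq> palindromes G S \<and>
        foldr (\<lambda>p acc. p \<otimes>\<^bsub>G\<^esub> acc) ps \<one>\<^bsub>G\<^esub> = g)"

locale finitely_generated_group = group G for G (structure) +
  fixes S
  assumes finite_generators: "finite S"
    and generators_closed: "S \<subseteq> carrier G"
    and generate_generators: "generate G S = carrier G"
begin

abbreviation word_over :: "('a \<times> bool) list \<Rightarrow> bool" where
  "word_over w \<equiv> fst ` set w \<subseteq> S"

lemma word_eval_Nil [simp]: "word_eval G [] = \<one>"
  by (simp add: word_eval_def)

lemma word_eval_Cons:
  "word_eval G (a # w) = (if snd a then fst a else inv fst a) \<otimes> word_eval G w"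
  by (simp add: word_eval_def case_prod_beta)

lemma word_eval_closed [simp]: "word_over w \<Longrightarrow> word_eval G w \<in> carrier G"
  using generators_closed by (induction w) (auto simp: word_eval_Cons)

lemma word_eval_append:
  "word_over u \<Longrightarrow> word_over v \<Longrightarrow> word_eval G (u @ v) = word_eval G u \<otimes> word_eval G v"
  using generators_closed by (induction u) (auto simp: word_eval_Cons m_assoc)

lemma word_eval_inverse:
  "word_over w \<Longrightarrow> word_eval G (rev (map (apsnd Not) w)) = inv word_eval G w"
proof (induction w)
  case (Cons a w)
  have a: "fst a \<in> carrier G" using Cons.prems generators_closed by auto
  have "word_over (rev (map (apsnd Not) w))" using Cons.prems by (auto simp: image_iff)
  moreover have "word_over [apsnd Not a]" using Cons.prems by simp
  ultimately show ?case
    using Cons a by (simp add: word_eval_append word_eval_Cons inv_mult_group)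
qed simp

lemma exists_word:
  assumes "g \<in> carrier G"
  shows "\<exists>w. word_over w \<and> word_eval G w = g"
proof -
  have "g \<in> generate G S" using assms by (simp add: generate_generators)
  then show ?thesis
  proof induction
    case one
    show ?case by (rule exI [of _ "[]"]) simp
  next
    case (incl h)
    then show ?case using generators_closed
      by (intro exI [of _ "[(h, True)]"]) (auto simp: word_eval_Cons)
  next
    case (inv h)
    then show ?case using generators_closed
      by (intro exI [of _ "[(h, False)]"]) (auto simp: word_eval_Cons)
  next
    case (eng h1 h2)
    then obtain w1 w2 where "word_over w1" "word_eval G w1 = h1" "word_over w2" "word_eval G w2 = h2"
      by blast
    then show ?case
      by (intro exI [of _ "w1 @ w2"]) (auto simp: word_eval_append)
  qed
qed

section \<open>Palindromes as group elements\<close>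

lemma palindromes_closed: "p \<in> palindromes G S \<Longrightarrow> p \<in> carrier G"
  by (auto simp: palindromes_def)

lemma palindromesI:
  "word_over w \<Longrightarrow> reduced_word w \<Longrightarrow> rev w = w \<Longrightarrow> word_eval G w \<in> palindromes G S"
  by (auto simp: palindromes_def)

text \<open>Palindromes are values of reduced words, but \<open>a # w @ [a]\<close> may fail to be
  reduced. Then the first and last letters of \<open>w\<close> are both inverse to \<open>a\<close>,
  and cancelling leaves a shorter reduced palindrome: the inside of \<open>w\<close>, or
  \<open>[a]\<close> if \<open>w\<close> is a single letter.\<close>

lemma palindromes_conj_letter:
  assumes p: "p \<in> palindromes G S" and a: "fst a \<in> S"
  shows "word_eval G [a] \<otimes> p \<otimes> word_eval G [a] \<in> palindromes G S"
proof -
  obtain w where w: "word_over w" "reduced_word w" "rev w = w" and p_eq: "p = word_eval G w"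
    using p by (auto simp: palindromes_def)
  define c where "c = (if snd a then fst a else inv fst a)"
  have c: "c \<in> carrier G" "word_eval G [a] = c"
    using a generators_closed by (auto simp: c_def word_eval_Cons)
  have inverse_letter: "word_eval G (b # v) = inv c \<otimes> word_eval G v"
    "b = (fst a, \<not> snd a)" if "fst b = fst a" "snd b \<noteq> snd a" for b v
    using that a generators_closed by (auto simp: c_def word_eval_Cons prod_eq_iff)
  show ?thesis
  proof (cases "reduced_word (a # w @ [a])")
    case True
    have "word_eval G (a # w @ [a]) = c \<otimes> p \<otimes> c"
      using w(1) a c by (simp add: word_eval_Cons word_eval_append p_eq c_def m_assoc)
    then show ?thesis
      using palindromesI [OF _ True] w a c by simp
  next
    case False
    have single: "reduced_word [a]" by (simp add: reduced_word_def)
    from w(3) show ?thesis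
    proof (cases rule: palindrome_cases)
      case 1
      then show ?thesis using False by (simp add: reduced_word_iff_successively)
    next
      case (2 b)
      then have b: "fst b = fst a" "snd b \<noteq> snd a"
        using False by (auto simp: reduced_word_iff_successively)
      have "c \<otimes> p \<otimes> c = c"
        using c inverse_letter(1) [OF b, of "[]"] by (simp add: p_eq 2)
      then show ?thesis
        using palindromesI [OF _ single] a c by simp
    next
      case (3 b v)
      then have b: "fst b = fst a" "snd b \<noteq> snd a"
        using False w(2) unfolding 3(1) reduced_word_enclose by blast+
      have v: "word_over v" using w(1) unfolding 3(1) by auto
      have "word_eval G w = inv c \<otimes> (word_eval G v \<otimes> inv c)"
        using inverse_letter(1) [OF b] inverse_letter(1) [OF b, of "[]"] c v a b
        by (simp add: 3(1) word_eval_append)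
      then have "c \<otimes> p \<otimes> c = word_eval G v"
        using c v by (simp add: p_eq m_assoc inv_mult_cancel_left)
      moreover have "reduced_word v"
        using w(2) unfolding 3(1) by (rule reduced_word_inner)
      ultimately show ?thesis
        using palindromesI [OF v _ 3(2)] c by simp
    qed
  qed
qed

text \<open>Wrapping one letter at a time absorbs all cancellation, so \<open>w\<close> can be any
  word representing a given element.\<close>

lemma palindromes_conj_word:
  assumes "p \<in> palindromes G S" "word_over w"
  shows "word_eval G w \<otimes> p \<otimes> word_eval G (rev w) \<in> palindromes G S"
  using assms(2)
proof (induction w)
  case Nil
  then show ?case using assms palindromes_closed by simp
next
  case (Cons a w)
  have "word_eval G (a # w) \<otimes> p \<otimes> word_eval G (rev (a # w))
      = word_eval G [a] \<otimes> (word_eval G w \<otimes> p \<otimes> word_eval G (rev w)) \<otimes> word_eval G [a]"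
  proof -
    have "word_over [a]" "word_over w" "word_over (rev w)" using Cons.prems by auto
    then show ?thesis
      using word_eval_append [of "[a]" w] word_eval_append [of "rev w" "[a]"]
        palindromes_closed [OF assms(1)]
      by (simp add: m_assoc)
  qed
  then show ?case
    using Cons palindromes_conj_letter [of _ a] by simp
qed

lemma one_palindrome: "\<one> \<in> palindromes G S"
  using palindromesI [of "[]"] by (simp add: reduced_word_def)

lemma letter_palindrome: "fst a \<in> S \<Longrightarrow> word_eval G [a] \<in> palindromes G S"
  by (intro palindromesI) (auto simp: reduced_word_def)

text \<open>Hence the cyclic subgroup of a generator consists of palindromes, which is what bounds
  \<open>G\<close> modulo its derived subgroup.\<close>

lemma power_palindrome:
  assumes "x \<in> S"
  shows "x [^] (k::int) \<in> palindromes G S"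
proof -
  have pal: "word_eval G (replicate n (x, b)) \<in> palindromes G S" for n b
    using assms by (intro palindromesI) (auto simp: reduced_word_def)
  have x: "x \<in> carrier G" using assms generators_closed by blast
  have "word_eval G (replicate n (x, b)) = (if b then x else inv x) [^] n" for n b
    using x by (induction n) (auto simp: word_eval_Cons simp flip: nat_pow_Suc2)
  then have "x [^] n \<in> palindromes G S" "inv x [^] n \<in> palindromes G S" for n :: nat
    using pal [of n True] pal [of n False] by simp_all
  then show ?thesis
    using x by (cases k rule: int_cases2) (simp_all add: int_pow_int int_pow_neg_int nat_pow_inv)
qed

text \<open>With \<open>g\<^sup>*\<close> the value of the reversed word, \<open>[x, g] = x (g x\<^sup>-\<^sup>1 g\<^sup>*) (g\<^sup>*\<^sup>-\<^sup>1 g\<^sup>-\<^sup>1)\<close>.\<close>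

lemma commutator_letter:
  assumes a: "fst a \<in> S" and g: "g \<in> carrier G"
  shows "\<exists>p\<in>palindromes G S. \<exists>q\<in>palindromes G S. \<exists>r\<in>palindromes G S.
    commutator (word_eval G [a]) g = p \<otimes> (q \<otimes> r)"
proof -
  obtain u where u: "word_over u" "word_eval G u = g" using exists_word [OF g] by blast
  define c where "c = word_eval G [a]"
  define d where "d = word_eval G (rev u)"
  have c: "c \<in> carrier G" "d \<in> carrier G" using a u by (auto simp: c_def d_def)
  have inv_c: "inv c = word_eval G [apsnd Not a]"
    using word_eval_inverse [of "[a]"] a by (simp add: c_def)
  have "inv c \<in> palindromes G S"
    using letter_palindrome [of "apsnd Not a"] a by (simp add: inv_c)
  then have "g \<otimes> inv c \<otimes> d \<in> palindromes G S"
    using palindromes_conj_word [OF _ u(1)] by (simp add: u d_def)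
  \<comment> \<open>Inverting \<open>u\<close> letter by letter gives a word of value
    \<open>inv d\<close> whose reverse has value \<open>inv g\<close>; wrap it around the palindrome
    \<open>\<one>\<close>.\<close>
  moreover have "inv d \<otimes> inv g \<in> palindromes G S"
  proof -
    have o: "word_over (map (apsnd Not) u)" using u(1) by (auto simp: image_iff)
    have "word_eval G (map (apsnd Not) u) = inv d"
      using word_eval_inverse [of "rev u"] u(1) by (simp add: d_def rev_map)
    moreover have "word_eval G (rev (map (apsnd Not) u)) = inv g"
      using word_eval_inverse u by blast
    ultimately show ?thesis
      using palindromes_conj_word [OF one_palindrome o] c by simp
  qed
  moreover have "commutator c g = c \<otimes> ((g \<otimes> inv c \<otimes> d) \<otimes> (inv d \<otimes> inv g))"
    using c g by (simp add: word_simps)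
  ultimately show ?thesis
    using letter_palindrome [OF a] unfolding c_def by blast
qed

section \<open>Sets of bounded palindromic length\<close>

abbreviation bdd :: "'a set \<Rightarrow> bool" where
  "bdd \<equiv> palindromically_bounded G S"

lemma bdd_subset: "bdd T \<Longrightarrow> U \<subseteq> T \<Longrightarrow> bdd U"
  unfolding palindromically_bounded_def by (meson subsetD)

lemma bdd_palindromes: "bdd (palindromes G S)"
  unfolding palindromically_bounded_def
proof (intro exI ballI conjI)
  fix p assume p: "p \<in> palindromes G S"
  show "length [p] \<le> 1" "set [p] \<subseteq> palindromes G S" "foldr (\<otimes>) [p] \<one> = p"
    using p palindromes_closed by auto
qed

lemma bdd_mult:
  assumes "bdd A" "bdd B"
  shows "bdd (A <#> B)"
proof -
  let ?P = "\<lambda>ps. foldr (\<otimes>) ps \<one>"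
  have closed: "?P ps \<in> carrier G" if "set ps \<subseteq> palindromes G S" for ps
    using that palindromes_closed by (induction ps) auto
  have append: "?P (ps @ qs) = ?P ps \<otimes> ?P qs"
    if "set ps \<subseteq> palindromes G S" "set qs \<subseteq> palindromes G S" for ps qs
    using that(1) closed closed [OF that(2)] palindromes_closed
    by (induction ps) (auto simp: m_assoc)
  obtain M where M: "\<And>g. g \<in> A \<Longrightarrow> \<exists>ps. length ps \<le> M \<and> set ps \<subseteq> palindromes G S \<and> ?P ps = g"
    using assms(1) unfolding palindromically_bounded_def by blast
  obtain N where N: "\<And>g. g \<in> B \<Longrightarrow> \<exists>ps. length ps \<le> N \<and> set ps \<subseteq> palindromes G S \<and> ?P ps = g"
    using assms(2) unfolding palindromically_bounded_def by blast
  show ?thesis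
    unfolding palindromically_bounded_def
  proof (intro exI [of _ "M + N"] ballI)
    fix g assume "g \<in> A <#> B"
    then obtain a b where ab: "a \<in> A" "b \<in> B" "g = a \<otimes> b"
      unfolding set_mult_def by blast
    obtain ps qs where "length ps \<le> M" "set ps \<subseteq> palindromes G S" "?P ps = a"
        "length qs \<le> N" "set qs \<subseteq> palindromes G S" "?P qs = b"
      using M [OF ab(1)] N [OF ab(2)] by blast
    then show "\<exists>ps. length ps \<le> M + N \<and> set ps \<subseteq> palindromes G S \<and> ?P ps = g"
      using append ab by (intro exI [of _ "ps @ qs"]) auto
  qed
qed

lemma bdd_one: "bdd {\<one>}"
  using bdd_palindromes one_palindrome by (auto intro: bdd_subset)

text \<open>Letters and their inverses are handled by \<open>commutator_letter\<close>. Products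
  follow from \<open>[u v, g] = [u, v g v^-1] [v, g]\<close>, where \<open>v g v^-1\<close> is again
  an arbitrary element. The bound depends on \<open>t\<close>, which is why later arguments use
  finite sets \<open>T\<close>.\<close>

lemma bdd_commutators:
  assumes "t \<in> carrier G"
  shows "bdd {commutator t g | g. g \<in> carrier G}"
proof -
  have letter: "bdd {commutator (word_eval G [a]) g | g. g \<in> carrier G}" if "fst a \<in> S" for a
  proof (rule bdd_subset)
    show "bdd (palindromes G S <#> (palindromes G S <#> palindromes G S))"
      by (intro bdd_mult bdd_palindromes)
    show "{commutator (word_eval G [a]) g | g. g \<in> carrier G}
        \<subseteq> palindromes G S <#> (palindromes G S <#> palindromes G S)"
    proof clarify
      fix g assume "g \<in> carrier G"
      from commutator_letter [OF that this]
      obtain p q r where "p \<in> palindromes G S" "q \<in> palindromes G S" "r \<in> palindromes G S"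
        and eq: "commutator (word_eval G [a]) g = p \<otimes> (q \<otimes> r)"
        by blast
      then show "commutator (word_eval G [a]) g \<in> palindromes G S <#> (palindromes G S <#> palindromes G S)"
        unfolding eq by (intro set_multI)
    qed
  qed
  have "t \<in> generate G S" using assms by (simp add: generate_generators)
  then show ?thesis
  proof induction
    case one
    then show ?case
      by (auto intro!: bdd_subset [OF bdd_one] simp: commutator_def)
  next
    case (incl h)
    then have "h \<in> carrier G" using generators_closed by blast
    then show ?case using letter [of "(h, True)"] incl by (simp add: word_eval_Cons)
  next
    case (inv h)
    then have "h \<in> carrier G" using generators_closed by blast
    then show ?case using letter [of "(h, False)"] inv by (simp add: word_eval_Cons)
  next
    case (eng u v)
    then have uv: "u \<in> carrier G" "v \<in> carrier G" by (simp_all add: generate_generators)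
    show ?case
    proof (rule bdd_subset [OF bdd_mult [OF eng.IH]], clarify)
      fix g assume g: "g \<in> carrier G"
      have "commutator (u \<otimes> v) g = commutator u (v \<otimes> g \<otimes> inv v) \<otimes> commutator v g"
        using uv g by (simp add: word_simps)
      then show "commutator (u \<otimes> v) g \<in> {commutator u g | g. g \<in> carrier G} <#> {commutator v g | g. g \<in> carrier G}"
        using uv g by (auto intro!: set_multI)
    qed
  qed
qed

section \<open>Bounding commutator subgroups\<close>

text \<open>Modulo \<open>K\<close> the maps \<open>b \<mapsto> [t, b]\<close> are homomorphisms on \<open>B\<close> with pairwise commuting images,
  so the product over \<open>t \<in> T\<close> of their images is already a subgroup.\<close>

lemma bdd_commutator_subgroup:
  assumes "finite T" and T: "T \<subseteq> carrier G"
    and B: "B \<lhd> G" and K: "K \<lhd> G" "K \<subseteq> B" "bdd K"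
    and comm: "\<And>t b b'. t \<in> T \<Longrightarrow> b \<in> B \<Longrightarrow> b' \<in> B \<Longrightarrow> commutator b (commutator t b') \<in> K"
  shows "\<exists>L. subgroup L G \<and> K \<subseteq> L \<and> L \<subseteq> B \<and> bdd L \<and> (\<forall>t\<in>T. \<forall>b\<in>B. commutator t b \<in> L)"
  using assms(1) T comm
proof (induction T)
  case empty
  then show ?case
    using K by (intro exI [of _ K]) (auto intro: normal_imp_subgroup)
next
  case (insert t T)
  note Bc = normal_in_carrier [OF B]
  have t: "t \<in> carrier G" using insert.prems by simp
  obtain L where L: "subgroup L G" "K \<subseteq> L" "L \<subseteq> B" "bdd L"
    and TL: "\<And>s b. s \<in> T \<Longrightarrow> b \<in> B \<Longrightarrow> commutator s b \<in> L"
    using insert by (metis insert_iff subset_insertI subset_trans)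
  note Lm = subgroup.m_closed [OF L(1)] and Li = subgroup.m_inv_closed [OF L(1)]
  have Lc: "z \<in> carrier G" if "z \<in> L" for z using that L Bc by blast
  have one: "\<one> \<in> B" "\<one> \<in> L"
    using B L normal_imp_subgroup subgroup.one_closed by blast+
  define L' where "L' = {commutator t b \<otimes> z | b z. b \<in> B \<and> z \<in> L}"
  have L'I: "commutator t b \<otimes> z \<in> L'" if "b \<in> B" "z \<in> L" for b z
    using that by (auto simp: L'_def)
  have tB: "commutator t b \<in> B" if "b \<in> B" for b
    using normal_commutator [OF B t that] by simp
  have comm: "commutator b (commutator t b') \<in> K" if "b \<in> B" "b' \<in> B" for b b'
    using insert.prems that by blast
  have "subgroup L' G"
  proof (rule subgroupI)
    show "L' \<subseteq> carrier G" using t Bc Lc by (auto simp: L'_def)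
    show "L' \<noteq> {}" using L'I one by blast
    fix g assume "g \<in> L'"
    then obtain b z where g: "g = commutator t b \<otimes> z" and bz: "b \<in> B" "z \<in> L"
      by (auto simp: L'_def)
    define c where "c = commutator t (inv b)"
    \<comment> \<open>Since \<open>[t, b]^-1 = b c b^-1 = [b, c] c\<close>, the inverse of
      \<open>g\<close> is \<open>w c\<close>. Moving \<open>c\<close> to the front costs a conjugate
      of \<open>[w, c]\<close>, which lies in \<open>K\<close>.\<close>
    define w where "w = inv z \<otimes> commutator b c"
    have ib: "inv b \<in> B" using bz B normal_inv by blast
    have bc: "commutator b c \<in> K" using comm bz ib by (simp add: c_def)
    have w: "w \<in> L" unfolding w_def using bc L(2) bz by (intro Lm Li) auto
    have "commutator w c \<in> K" using comm w L(3) ib by (auto simp: c_def)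
    moreover have "c \<in> carrier G" using t bz Bc by (simp add: c_def)
    ultimately have "inv c \<otimes> commutator w c \<otimes> c \<in> L"
      using L(2) K(1) normal_conj(2) by blast
    then have "inv c \<otimes> commutator w c \<otimes> c \<otimes> w \<in> L"
      using w by (rule Lm)
    moreover have "inv g = c \<otimes> (inv c \<otimes> commutator w c \<otimes> c \<otimes> w)"
      using t bz Bc Lc by (simp add: g w_def c_def word_simps)
    ultimately show "inv g \<in> L'" using L'I ib by (simp add: c_def)
    fix h assume "h \<in> L'"
    then obtain b' z' where h: "h = commutator t b' \<otimes> z'" and bz': "b' \<in> B" "z' \<in> L"
      by (auto simp: L'_def)
    define c' where "c' = commutator t b'"
    have c': "c' \<in> carrier G" using t bz' Bc by (simp add: c'_def)
    \<comment> \<open>The error terms of the product: \<open>[t, b b'] = [t, b] [b, c'] c'\<close>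
      and \<open>z c' = [z, c'] c' z\<close>.\<close>
    have "inv (commutator b c') \<otimes> commutator z c' \<in> K"
      using comm bz bz' L(3) K unfolding c'_def by (intro normal_mult normal_inv) auto
    then have "inv c' \<otimes> (inv (commutator b c') \<otimes> commutator z c') \<otimes> c' \<in> L"
      using L(2) K(1) c' normal_conj(2) by blast
    then have "inv c' \<otimes> (inv (commutator b c') \<otimes> commutator z c') \<otimes> c' \<otimes> (z \<otimes> z') \<in> L"
      using Lm [OF bz(2) bz'(2)] by (rule Lm)
    moreover have "b \<otimes> b' \<in> B" using bz bz' B normal_mult by blast
    moreover have "g \<otimes> h = commutator t (b \<otimes> b')
        \<otimes> (inv c' \<otimes> (inv (commutator b c') \<otimes> commutator z c') \<otimes> c' \<otimes> (z \<otimes> z'))"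
      using t bz bz' Bc Lc by (simp add: g h c'_def word_simps)
    ultimately show "g \<otimes> h \<in> L'" using L'I by simp
  qed
  moreover have LL': "L \<subseteq> L'"
  proof
    fix z assume "z \<in> L"
    then show "z \<in> L'" using L'I [OF one(1), of z] t Lc by (simp add: commutator_def)
  qed
  moreover have "commutator t b \<in> L'" if "b \<in> B" for b
    using L'I [OF that one(2)] t that Bc by simp
  moreover have "L' \<subseteq> B"
    using tB L(3) B by (auto simp: L'_def intro: normal_mult)
  moreover have "bdd L'"
  proof (rule bdd_subset)
    show "bdd ({commutator t g | g. g \<in> carrier G} <#> L)"
      by (intro bdd_mult bdd_commutators t L(4))
    show "L' \<subseteq> {commutator t g | g. g \<in> carrier G} <#> L"
      using Bc by (auto simp: L'_def intro!: set_multI)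
  qed
  ultimately show ?case using L(2) TL by (intro exI [of _ L']) auto
qed

text \<open>The preceding lemma with \<open>T = S\<close> gives a bounded subgroup \<open>L\<close>
  containing all \<open>[x, B]\<close> for generators \<open>x\<close>. The elements
  \<open>g\<close> with \<open>[g, B] \<subseteq> L\<close> form a subgroup, hence all of
  \<open>G\<close>.\<close>

lemma bdd_comm_subgroup_of_abelian_mod:
  assumes B: "B \<lhd> G" and K: "K \<lhd> G" "K \<subseteq> B" "bdd K"
    and abelian: "\<And>b b'. b \<in> B \<Longrightarrow> b' \<in> B \<Longrightarrow> commutator b b' \<in> K"
  shows "bdd (comm_subgroup G (carrier G) B)"
proof -
  have "\<exists>L. subgroup L G \<and> K \<subseteq> L \<and> L \<subseteq> B \<and> bdd L \<and> (\<forall>t\<in>S. \<forall>b\<in>B. commutator t b \<in> L)"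
    using generators_closed normal_commutator [OF B]
    by (intro bdd_commutator_subgroup finite_generators generators_closed B K abelian) auto
  then obtain L where L: "subgroup L G" "bdd L" "\<forall>t\<in>S. \<forall>b\<in>B. commutator t b \<in> L"
    by blast
  have "generate G S \<subseteq> {g \<in> carrier G. \<forall>b\<in>B. commutator g b \<in> L}"
    using L generators_closed by (intro generate_subgroup_incl subgroup_commutator_left B) auto
  then have "comm_subgroup G (carrier G) B \<subseteq> L"
    using L by (intro comm_subgroup_least) (auto simp: generate_generators)
  then show ?thesis using L(2) bdd_subset by blast
qed

text \<open>Put \<open>M = [H, B]\<close> and \<open>K = [G, M]\<close>, so that \<open>M\<close> is
  central modulo \<open>K\<close>. A bounded subgroup contains all \<open>[t, B]\<close> with
  \<open>t \<in> T\<close>; cut down to \<open>M\<close> it is normal, so normal generation carries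
  the property from \<open>T\<close> to \<open>H\<close>.\<close>

lemma bdd_comm_subgroup_of_central_mod:
  assumes H: "H \<lhd> G" and B: "B \<lhd> G"
    and T: "finite T" "normally_generates G T H"
    and bdd: "bdd (comm_subgroup G (carrier G) (comm_subgroup G H B))"
  shows "bdd (comm_subgroup G H B)"
proof -
  define M where "M = comm_subgroup G H B"
  define K where "K = comm_subgroup G (carrier G) M"
  have Hc: "H \<subseteq> carrier G" using H normal_in_carrier by blast
  have TH: "T \<subseteq> H" using T by (simp add: normally_generates_def)
  have M: "M \<lhd> G" unfolding M_def by (intro normal_comm_subgroup H B)
  have K: "K \<lhd> G" unfolding K_def by (intro normal_comm_subgroup normal_self M)
  have KM: "K \<subseteq> M" unfolding K_def by (intro comm_subgroup_subset M) simp
  have MB: "M \<subseteq> B" unfolding M_def by (intro comm_subgroup_subset Hc B)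
  have GM: "commutator g z \<in> K" if "g \<in> carrier G" "z \<in> M" for g z
    using that by (simp add: K_def commutator_in_comm_subgroup)
  have HB: "commutator h b \<in> M" if "h \<in> H" "b \<in> B" for h b
    using that by (simp add: M_def commutator_in_comm_subgroup)
  have "\<exists>L. subgroup L G \<and> K \<subseteq> L \<and> L \<subseteq> B \<and> bdd L \<and> (\<forall>t\<in>T. \<forall>b\<in>B. commutator t b \<in> L)"
    using TH Hc KM MB GM HB bdd normal_in_carrier [OF B]
    by (intro bdd_commutator_subgroup B K T(1)) (auto simp: K_def M_def)
  then obtain L where L: "subgroup L G" "K \<subseteq> L" "bdd L" "\<forall>t\<in>T. \<forall>b\<in>B. commutator t b \<in> L"
    by blast
  \<comment> \<open>Between \<open>K\<close> and \<open>M\<close> every subgroup is normal: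
    \<open>x z x^-1 = [x, z] z\<close> with \<open>[x, z] \<in> K\<close>. Intersecting with
    \<open>M\<close> puts \<open>L\<close> in this range.\<close>
  have LM: "L \<inter> M \<lhd> G"
  proof (rule normal_invI)
    show sub: "subgroup (L \<inter> M) G"
      by (intro subgroups_Inter_pair L normal_imp_subgroup M)
    fix x z assume x: "x \<in> carrier G" and z: "z \<in> L \<inter> M"
    have "commutator x z \<otimes> z \<in> L \<inter> M"
      using z GM [OF x, of z] L(2) KM by (intro subgroup.m_closed [OF sub]) auto
    then show "x \<otimes> z \<otimes> inv x \<in> L \<inter> M"
      using x z normal_in_carrier [OF M] by (simp add: word_simps)
  qed
  have "T \<subseteq> {g \<in> carrier G. \<forall>b\<in>B. commutator g b \<in> L \<inter> M}"
    using TH Hc L(4) HB by auto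
  then have "H \<subseteq> {g \<in> carrier G. \<forall>b\<in>B. commutator g b \<in> L \<inter> M}"
    using T(2) normal_commutator_left [OF B LM] unfolding normally_generates_def by blast
  then have "M \<subseteq> L \<inter> M"
    unfolding M_def by (intro comm_subgroup_least normal_imp_subgroup LM [unfolded M_def]) auto
  then show ?thesis using L(3) bdd_subset unfolding M_def by blast
qed

text \<open>Modulo the derived subgroup, \<open>G\<close> is a product of finitely many cyclic
  groups of generators, each made of palindromes. Subgroups above the derived subgroup are normal,
  so multiplying by one cyclic group at a time keeps a subgroup.\<close>

lemma bdd_carrier_of_bdd_derived:
  assumes "bdd (comm_subgroup G (carrier G) (carrier G))"
  shows "bdd (carrier G)"
proof -
  let ?D = "comm_subgroup G (carrier G) (carrier G)"
  have D: "?D \<lhd> G" by (intro normal_comm_subgroup normal_self)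
  have normal_above: "L \<lhd> G" if L: "subgroup L G" "?D \<subseteq> L" for L
  proof (rule normal_invI [OF L(1)])
    fix x z assume xz: "x \<in> carrier G" "z \<in> L"
    then have z: "z \<in> carrier G" using subgroup.mem_carrier [OF L(1)] by blast
    have "commutator x z \<in> L"
      using commutator_in_comm_subgroup [OF xz(1) z] L(2) by blast
    then have "commutator x z \<otimes> z \<in> L" using subgroup.m_closed [OF L(1)] xz(2) by blast
    then show "x \<otimes> z \<otimes> inv x \<in> L" using xz z by (simp add: word_simps)
  qed
  have "\<exists>L. subgroup L G \<and> ?D \<subseteq> L \<and> T \<subseteq> L \<and> bdd L" if "T \<subseteq> S" for T
    using finite_subset [OF that finite_generators] that
  proof (induction T)
    case empty
    then show ?case using assms D by (intro exI [of _ ?D]) (auto intro: normal_imp_subgroup)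
  next
    case (insert x T)
    then obtain L where L: "subgroup L G" "?D \<subseteq> L" "T \<subseteq> L" "bdd L" by auto
    let ?P = "generate G {x}"
    have x: "x \<in> carrier G" "x \<in> S" using insert.prems generators_closed by auto
    have P: "subgroup ?P G" using x by (intro generate_is_subgroup) auto
    have one: "\<one> \<in> L" "\<one> \<in> ?P" using L P subgroup.one_closed by blast+
    have "subgroup (?P <#> L) G"
      using mult_norm_subgroup [OF normal_above [OF L(1,2)] P]
        commut_normal [OF P normal_above [OF L(1,2)]] by simp
    moreover have LP: "L \<subseteq> ?P <#> L"
    proof
      fix z assume "z \<in> L"
      then have "z = \<one> \<otimes> z" using L(1) subgroup.mem_carrier by fastforce
      then show "z \<in> ?P <#> L" using one \<open>z \<in> L\<close> set_multI by metis
    qed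
    moreover have "x \<in> ?P <#> L"
    proof -
      have "x = x \<otimes> \<one>" using x by simp
      moreover have "x \<in> ?P" by (simp add: generate.incl)
      ultimately show ?thesis using one set_multI by metis
    qed
    moreover have "bdd (?P <#> L)"
    proof (intro bdd_mult L)
      show "bdd ?P"
        using power_palindrome [OF x(2)] generate_pow [OF x(1)]
        by (intro bdd_subset [OF bdd_palindromes]) auto
    qed
    ultimately show ?case using L by (intro exI [of _ "?P <#> L"]) auto
  qed
  then obtain L where L: "subgroup L G" "S \<subseteq> L" "bdd L" by blast
  then have "carrier G \<subseteq> L"
    using generate_subgroup_incl [of S L] generate_generators by simp
  then show ?thesis using L(3) bdd_subset by blast
qed

section \<open>Climbing the two lower series\<close>

lemma generators_normally_generate: "normally_generates G S (carrier G)"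
  unfolding normally_generates_def
  using generate_subgroup_incl [OF _ normal_imp_subgroup, of S] generators_closed
  by (simp add: generate_generators)

lemma lower_series_normally_generated:
  "\<exists>T. finite T \<and> normally_generates G T (lower_series G (carrier G) n)"
proof (induction n)
  case 0
  show ?case
    using finite_generators generators_normally_generate by auto
next
  case (Suc n)
  then obtain T where T: "finite T" "normally_generates G T (lower_series G (carrier G) n)"
    by blast
  have "{commutator x t | x t. x \<in> S \<and> t \<in> T} = (\<lambda>(x, t). commutator x t) ` (S \<times> T)"
    by auto
  then have "finite {commutator x t | x t. x \<in> S \<and> t \<in> T}"
    using T(1) finite_generators by simp
  moreover have "lower_series G (carrier G) n \<subseteq> carrier G"
    using lower_central_subgroup [OF subgroup_self] by blast
  ultimately show ?case
    using normally_generates_comm_subgroup [OF generators_closed generate_generators _ T(2)]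
    by auto
qed

lemma bdd_carrier_of_abelian_lower_series:
  fixes c d
  defines "H \<equiv> lower_series G (carrier G) d"
  assumes abelian: "\<And>x y. x \<in> lower_series G H c \<Longrightarrow> y \<in> lower_series G H c \<Longrightarrow> commutator x y = \<one>"
  shows "bdd (carrier G)"
proof -
  let ?G = "\<lambda>n. lower_series G (carrier G) n" and ?H = "\<lambda>n. lower_series G H n"
  have GN: "?G n \<lhd> G" for n by (intro normal_lower_series normal_self)
  have H: "H \<lhd> G" using GN by (simp add: H_def)
  have HN: "?H n \<lhd> G" for n by (intro normal_lower_series H)
  obtain T where T: "finite T" "normally_generates G T H"
    using lower_series_normally_generated unfolding H_def by blast
  \<comment> \<open>The climb starts with \<open>K\<close> trivial, as \<open>?H c\<close> is
    abelian.\<close>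
  have "bdd (comm_subgroup G (carrier G) (?H c))"
    using bdd_comm_subgroup_of_abelian_mod [OF HN one_is_normal _ bdd_one]
      abelian subgroup.one_closed [OF normal_imp_subgroup [OF HN]] by simp
  \<comment> \<open>Two moves per level: \<open>[G, [H, ?H n]]\<close> bounds
    \<open>?H (Suc n) = [H, ?H n]\<close>, and \<open>?H n\<close> is abelian modulo
    \<open>?H (Suc n)\<close> because it lies in \<open>H\<close>.\<close>
  moreover have "bdd (comm_subgroup G (carrier G) (?H n))"
    if "bdd (comm_subgroup G (carrier G) (?H (Suc n)))" for n
  proof (rule bdd_comm_subgroup_of_abelian_mod [OF HN HN [of "Suc n"]])
    show "?H (Suc n) \<subseteq> ?H n"
      using comm_subgroup_subset [OF _ HN, of H n] H normal_in_carrier by auto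
    show "bdd (?H (Suc n))"
      using bdd_comm_subgroup_of_central_mod [OF H HN T] that by simp
    fix b b' assume "b \<in> ?H n" "b' \<in> ?H n"
    then show "commutator b b' \<in> ?H (Suc n)"
      using lower_central_subgroup [OF normal_imp_subgroup [OF H], of n]
      by (auto intro: commutator_in_comm_subgroup)
  qed
  ultimately have "bdd (comm_subgroup G (carrier G) (?H 0))"
    by (induction c) auto
  \<comment> \<open>\<open>?H 0\<close> is \<open>?G d\<close>, so \<open>[G, ?H 0]\<close> is the
    next term of the series of \<open>G\<close>. The climb from there takes \<open>G\<close> for
    \<open>H\<close> and \<open>S\<close> for \<open>T\<close>; it ends at index 1, since each move
    yields a commutator subgroup.\<close>
  then have "bdd (?G (Suc d))" by (simp add: H_def)
  moreover have "bdd (?G (Suc n))" if "bdd (?G (Suc (Suc n)))" for n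
    using that bdd_comm_subgroup_of_central_mod
      [OF normal_self GN finite_generators generators_normally_generate, of n] by simp
  ultimately have "bdd (?G (Suc 0))"
    by (induction d) auto
  then show ?thesis using bdd_carrier_of_bdd_derived by simp
qed

end

section \<open>Abelian-by-nilpotent-by-nilpotent groups\<close>

text \<open>Here \<open>d\<close> and \<open>c\<close> are indices at which the lower central series
  of the outer quotient and of \<open>N\<close> become trivial: the \<open>d\<close>-th term of
  \<open>G\<close> maps into \<open>N\<close>, and the \<open>c\<close>-th term of its own series
  then maps to the identity of \<open>G Mod A\<close>.\<close>

lemma UNN_group_lower_series:
  assumes "UNN_group G"
  obtains A c d where "A \<lhd> G" "comm_group (G\<lparr>carrier := A\<rparr>)"
    "lower_series G (lower_series G (carrier G) d) c \<subseteq> A"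
proof -
  obtain A N where "group G" and A: "A \<lhd> G" and comm: "comm_group (G\<lparr>carrier := A\<rparr>)"
    and N: "N \<lhd> (G Mod A)" and nil1: "nilpotent_group ((G Mod A)\<lparr>carrier := N\<rparr>)"
    and nil2: "nilpotent_group ((G Mod A) Mod N)"
    using assms unfolding UNN_group_def by blast
  interpret G: group G by fact
  interpret A: normal A G by (rule A)
  interpret Q: group "G Mod A" by (rule A.factorgroup_is_group)
  interpret N: normal N "G Mod A" by (rule N)
  interpret R: group "(G Mod A) Mod N" by (rule N.factorgroup_is_group)
  interpret p: group_hom G "G Mod A" "\<lambda>x. A #>\<^bsub>G\<^esub> x"
    by unfold_locales (rule A.r_coset_hom_Mod)
  interpret q: group_hom "G Mod A" "(G Mod A) Mod N" "\<lambda>x. N #>\<^bsub>G Mod A\<^esub> x"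
    by unfold_locales (rule N.r_coset_hom_Mod)
  obtain d where d: "lower_central ((G Mod A) Mod N) d = {\<one>\<^bsub>(G Mod A) Mod N\<^esub>}"
    using nil2 unfolding nilpotent_group_def by blast
  obtain c where c: "lower_central ((G Mod A)\<lparr>carrier := N\<rparr>) c = {\<one>\<^bsub>G Mod A\<^esub>}"
    using nil1 unfolding nilpotent_group_def by auto
  let ?H = "lower_series G (carrier G) d"
  have H: "?H \<subseteq> carrier G"
    using G.lower_central_subgroup [OF G.subgroup_self] by blast
  have pc: "(\<lambda>x. A #>\<^bsub>G\<^esub> x) ` carrier G \<subseteq> carrier (G Mod A)"
    and qc: "(\<lambda>x. N #>\<^bsub>G Mod A\<^esub> x) ` carrier (G Mod A) \<subseteq> carrier ((G Mod A) Mod N)"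
    using p.hom_closed q.hom_closed by blast+
  \<comment> \<open>Pushed through both quotient maps, \<open>x\<close> lands in the trivial
    \<open>d\<close>-th term, so its image in \<open>G Mod A\<close> lies in the kernel
    \<open>N\<close> of the second map.\<close>
  have "A #>\<^bsub>G\<^esub> x \<in> N" if "x \<in> ?H" for x
  proof -
    have x: "A #>\<^bsub>G\<^esub> x \<in> lower_series (G Mod A) (carrier (G Mod A)) d"
      using p.image_lower_series [OF _ _ pc] that by blast
    then have "N #>\<^bsub>G Mod A\<^esub> (A #>\<^bsub>G\<^esub> x) \<in> {\<one>\<^bsub>(G Mod A) Mod N\<^esub>}"
      using q.image_lower_series [OF _ _ qc, of d] d R.lower_central_eq by blast
    then have "N #>\<^bsub>G Mod A\<^esub> (A #>\<^bsub>G\<^esub> x) = N" by (simp add: FactGroup_def)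
    then show ?thesis
      using Q.coset_join1 N.subgroup_axioms N.subset p.hom_closed that H by blast
  qed
  then have "(\<lambda>x. A #>\<^bsub>G\<^esub> x) ` ?H \<subseteq> N" by blast
  then have im: "lower_series G ?H c \<subseteq> carrier G"
      "(\<lambda>x. A #>\<^bsub>G\<^esub> x) ` lower_series G ?H c \<subseteq> lower_series (G Mod A) N c"
    using p.image_lower_series [OF H N.subset] by blast+
  moreover have "lower_series (G Mod A) N c = {\<one>\<^bsub>G Mod A\<^esub>}"
    using Q.lower_central_subgroup [OF N.subgroup_axioms] c by simp
  ultimately have "A #>\<^bsub>G\<^esub> x = A" if "x \<in> lower_series G ?H c" for x
    using that by (auto simp: FactGroup_def)
  then have "lower_series G ?H c \<subseteq> A"
    using im(1) G.coset_join1 A.subgroup_axioms A.subset by blast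
  then show ?thesis using that A comm by blast
qed

theorem theorem1p2:
  fixes G :: "('a, 'b) monoid_scheme"
  assumes "group G"
    and "\<exists>Y. finite Y \<and> Y \<subseteq> carrier G \<and> generate G Y = carrier G"
    and "UNN_group G"
  shows "\<forall>S. finite S \<and> S \<subseteq> carrier G \<and> generate G S = carrier G
              \<longrightarrow> finite_palindromic_width G S"
proof (intro allI impI)
  fix S assume S: "finite S \<and> S \<subseteq> carrier G \<and> generate G S = carrier G"
  interpret group G by fact
  interpret finitely_generated_group G S
    using S by unfold_locales auto
  obtain A c d where A: "A \<lhd> G" "comm_group (G\<lparr>carrier := A\<rparr>)"
    and sub: "lower_series G (lower_series G (carrier G) d) c \<subseteq> A"
    using UNN_group_lower_series [OF assms(3)] .
  have "commutator x y = \<one>\<^bsub>G\<^esub>" if "x \<in> A" "y \<in> A" for x y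
  proof -
    have "x \<otimes>\<^bsub>G\<^esub> y = y \<otimes>\<^bsub>G\<^esub> x"
      using comm_groupE(4) [OF A(2)] that by simp
    moreover have "x \<in> carrier G" "y \<in> carrier G"
      using that normal_in_carrier [OF A(1)] by auto
    ultimately show ?thesis by (simp add: word_simps)
  qed
  then have "bdd (carrier G)"
    using sub by (intro bdd_carrier_of_abelian_lower_series [of d c]) blast
  then show "finite_palindromic_width G S"
    by (simp add: palindromically_bounded_def finite_palindromic_width_def)
qed

end
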